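(* Let $G$ be a locally compact abelian group and let $\varphi\in\mathcal{H}(G)$ be a Hartman measurable function. Any two group compactifications $(\iota_{X_1},X_1)$ and $(\iota_{X_2},X_2)$ of $G$ on which $\varphi$ has an aperiodic almost realization are equivalent.
   Context: $G$ is a locally compact abelian (LCA) group, written additively. A group compactification of $G$ is a pair $(\iota_X,X)$ with $X$ a compact (Hausdorff) group and $\iota_X:G\to X$ a continuous homomorphism with dense image; $\mu_X$ is the normalized Haar measure on $X$, $0_X$ the unit of $X$. Write $(\iota_{X_1},X_1)\le(\iota_{X_2},X_2)$ iff there is a continuous homomorphism $\pi:X_2\to X_1$ with $\iota_{X_1}=\pi\circ\iota_{X_2}$; two group compactifications are equivalent iff each is $\le$ the other. $(\iota_b,bG)$ denotes the Bohr compactification of $G$ (the maximal group compactification). A bounded function $f:X\to\mathbb{C}$ is Riemann integrable, $f\in R_{\mu_X}(X)$, iff its set of points of discontinuity is a $\mu_X$-null set. A bounded function $\varphi:G\to\mathbb{C}$ is Hartman measurable, $\varphi\in\mathcal{H}(G)$, iff $\varphi=\varphi_b\circ\iota_b$ for some $\varphi_b\in R_{\mu_b}(bG)$, where $\mu_b$ is Haar measure on $bG$. There is a unique invariant mean $m_G$ on $\mathcal{H}(G)$, given by $m_G(\varphi)=\int_X\varphi^*\,d\mu_X$ whenever $\varphi=\varphi^*\circ\iota_X$ with $\varphi^*\in R_{\mu_X}(X)$. A function $\psi^*\in R_{\mu_X}(X)$ is an almost realization of $\varphi\in\mathcal{H}(G)$ on $(\iota_X,X)$ iff $m_G(|\varphi-\psi^*\circ\iota_X|)=0$.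 It is aperiodic iff $\{x\in X:\|\psi^*-\tau_x\psi^*\|_1=0\}=\{0_X\}$, where $\|\cdot\|_1$ is the $L^1(\mu_X)$-norm and $\tau_x\psi^*(y)=\psi^*(x+y)$. *)

theory Defs
  imports "HOL-Analysis.Analysis" "HOL-Algebra.Coset"
begin

text \<open>
  Topological groups are carrier-based: a group of HOL-Algebra together with an abstract topology
  on its carrier. Groups are therefore written multiplicatively here, and the unit is
  \<open>\<one>\<^bsub>X\<^esub>\<close>. Functions on a group are total functions on the underlying type; only their values
  on the carrier ever matter.
\<close>

record 'a topgroup = "'a monoid" +
  gtop :: "'a topology"

definition topological_group :: "'a topgroup \<Rightarrow> bool" where
  "topological_group X \<longleftrightarrow>
     group X \<and> topspace (gtop X) = carrier X \<and>
     continuous_map (prod_topology (gtop X) (gtop X)) (gtop X) (\<lambda>(x, y). x \<otimes>\<^bsub>X\<^esub> y) \<and>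
     continuous_map (gtop X) (gtop X) (\<lambda>x. inv\<^bsub>X\<^esub> x)"

definition LCA_group :: "'g topgroup \<Rightarrow> bool" where
  "LCA_group G \<longleftrightarrow>
     topological_group G \<and> comm_group G \<and>
     Hausdorff_space (gtop G) \<and> locally_compact_space (gtop G)"

definition compact_group :: "'a topgroup \<Rightarrow> bool" where
  "compact_group X \<longleftrightarrow> topological_group X \<and> compact_space (gtop X) \<and> Hausdorff_space (gtop X)"

definition group_compactification :: "'g topgroup \<Rightarrow> 'x topgroup \<Rightarrow> ('g \<Rightarrow> 'x) \<Rightarrow> bool" where
  "group_compactification G X \<iota> \<longleftrightarrow>
     compact_group X \<and> \<iota> \<in> hom G X \<and> continuous_map (gtop G) (gtop X) \<iota> \<and>
     gtop X closure_of (\<iota> ` carrier G) = carrier X"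

definition compactification_le ::
  "'g topgroup \<Rightarrow> 'x topgroup \<Rightarrow> ('g \<Rightarrow> 'x) \<Rightarrow> 'y topgroup \<Rightarrow> ('g \<Rightarrow> 'y) \<Rightarrow> bool" where
  "compactification_le G X \<iota>X Y \<iota>Y \<longleftrightarrow>
     (\<exists>\<pi>. \<pi> \<in> hom Y X \<and> continuous_map (gtop Y) (gtop X) \<pi> \<and>
          (\<forall>g\<in>carrier G. \<iota>X g = \<pi> (\<iota>Y g)))"

definition compactification_equiv ::
  "'g topgroup \<Rightarrow> 'x topgroup \<Rightarrow> ('g \<Rightarrow> 'x) \<Rightarrow> 'y topgroup \<Rightarrow> ('g \<Rightarrow> 'y) \<Rightarrow> bool" where
  "compactification_equiv G X \<iota>X Y \<iota>Y \<longleftrightarrow>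
     compactification_le G X \<iota>X Y \<iota>Y \<and> compactification_le G Y \<iota>Y X \<iota>X"

text \<open>
  The Bohr compactification is the maximal group compactification. HOL cannot quantify over types
  inside a formula, so the competitors range over the compactifications whose points are of type
  \<open>'g set set\<close>. Nothing is lost: every group compactification, on whatever type, is equivalent
  to one of these (lemma \<open>compactification_canonical\<close>), hence is below the Bohr
  compactification (lemma \<open>bohr_compactification_maximal\<close>).
\<close>

definition bohr_compactification :: "'g topgroup \<Rightarrow> 'b topgroup \<Rightarrow> ('g \<Rightarrow> 'b) \<Rightarrow> bool" where
  "bohr_compactification G B \<iota>B \<longleftrightarrow>
     group_compactification G B \<iota>B \<and>
     (\<forall>(Y :: 'g set set topgroup) \<iota>. group_compactification G Y \<iota> \<longrightarrow> compactification_le G Y \<iota> B \<iota>B)"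

text \<open>
  Normalized Haar measure on the Borel sets. The group may fail to be second countable, so
  regularity does not come for free; without it uniqueness of the measure fails.
\<close>

definition haar_measure :: "'a topgroup \<Rightarrow> 'a measure \<Rightarrow> bool" where
  "haar_measure X \<mu> \<longleftrightarrow>
     space \<mu> = carrier X \<and>
     sets \<mu> = sigma_sets (carrier X) {U. openin (gtop X) U} \<and>
     emeasure \<mu> (carrier X) = 1 \<and>
     (\<forall>x\<in>carrier X. \<forall>A\<in>sets \<mu>. emeasure \<mu> (x <#\<^bsub>X\<^esub> A) = emeasure \<mu> A) \<and>
     (\<forall>A\<in>sets \<mu>. emeasure \<mu> A = (INF U\<in>{U. openin (gtop X) U \<and> A \<subseteq> U}. emeasure \<mu> U)) \<and>
     (\<forall>A\<in>sets \<mu>. emeasure \<mu> A = (SUP K\<in>{K. compactin (gtop X) K \<and> closedin (gtop X) K \<and> K \<subseteq> A}. emeasure \<mu> K))"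

definition riemann_integrable :: "'a topgroup \<Rightarrow> 'a measure \<Rightarrow> ('a \<Rightarrow> complex) \<Rightarrow> bool" where
  "riemann_integrable X \<mu> f \<longleftrightarrow>
     bounded (f ` carrier X) \<and>
     {x\<in>carrier X. \<not> topcontinuous_at (gtop X) euclidean f x} \<in> null_sets \<mu>"

text \<open>
  A Riemann integrable function need not be Borel measurable, but it is measurable with respect
  to the completed measure; hence all integrals are taken with respect to the completion.
\<close>

definition haar_integral :: "'a measure \<Rightarrow> ('a \<Rightarrow> complex) \<Rightarrow> complex" where
  "haar_integral \<mu> f = integral\<^sup>L (completion \<mu>) f"

definition L1_norm :: "'a measure \<Rightarrow> ('a \<Rightarrow> complex) \<Rightarrow> real" where
  "L1_norm \<mu> f = (LINT x|completion \<mu>. cmod (f x))"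

definition hartman_measurable ::
  "'g topgroup \<Rightarrow> 'b topgroup \<Rightarrow> ('g \<Rightarrow> 'b) \<Rightarrow> 'b measure \<Rightarrow> ('g \<Rightarrow> complex) \<Rightarrow> bool" where
  "hartman_measurable G B \<iota>B \<mu>B \<phi> \<longleftrightarrow>
     bounded (\<phi> ` carrier G) \<and>
     (\<exists>\<phi>b. riemann_integrable B \<mu>B \<phi>b \<and> (\<forall>g\<in>carrier G. \<phi> g = \<phi>b (\<iota>B g)))"

text \<open>
  The invariant mean on Hartman measurable functions, given by integrating a realization on the
  Bohr compactification; two such realizations agree at every common point of continuity, so
  almost everywhere.
\<close>

definition hartman_mean ::
  "'g topgroup \<Rightarrow> 'b topgroup \<Rightarrow> ('g \<Rightarrow> 'b) \<Rightarrow> 'b measure \<Rightarrow> ('g \<Rightarrow> complex) \<Rightarrow> complex" where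
  "hartman_mean G B \<iota>B \<mu>B \<phi> =
     (THE c. \<exists>\<phi>b. riemann_integrable B \<mu>B \<phi>b \<and> (\<forall>g\<in>carrier G. \<phi> g = \<phi>b (\<iota>B g)) \<and>
                  c = haar_integral \<mu>B \<phi>b)"

definition almost_realization ::
  "'g topgroup \<Rightarrow> 'b topgroup \<Rightarrow> ('g \<Rightarrow> 'b) \<Rightarrow> 'b measure \<Rightarrow> ('g \<Rightarrow> complex) \<Rightarrow>
   'x topgroup \<Rightarrow> ('g \<Rightarrow> 'x) \<Rightarrow> 'x measure \<Rightarrow> ('x \<Rightarrow> complex) \<Rightarrow> bool" where
  "almost_realization G B \<iota>B \<mu>B \<phi> X \<iota> \<mu> \<psi> \<longleftrightarrow>
     riemann_integrable X \<mu> \<psi> \<and>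
     hartman_mean G B \<iota>B \<mu>B (\<lambda>g. complex_of_real (cmod (\<phi> g - \<psi> (\<iota> g)))) = 0"

definition group_translate :: "'x topgroup \<Rightarrow> 'x \<Rightarrow> ('x \<Rightarrow> complex) \<Rightarrow> 'x \<Rightarrow> complex" where
  "group_translate X x \<psi> = (\<lambda>y. \<psi> (x \<otimes>\<^bsub>X\<^esub> y))"

definition aperiodic :: "'x topgroup \<Rightarrow> 'x measure \<Rightarrow> ('x \<Rightarrow> complex) \<Rightarrow> bool" where
  "aperiodic X \<mu> \<psi> \<longleftrightarrow>
     {x\<in>carrier X. L1_norm \<mu> (\<lambda>y. \<psi> y - group_translate X x \<psi> y) = 0} = {\<one>\<^bsub>X\<^esub>}"

lemma compactification_le_trans:
  assumes "compactification_le G X i Y j" "compactification_le G Y j Z k"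
  shows "compactification_le G X i Z k"
proof -
  obtain p where p: "p \<in> hom Y X" "continuous_map (gtop Y) (gtop X) p"
      "\<forall>g\<in>carrier G. i g = p (j g)"
    using assms(1) unfolding compactification_le_def by blast
  obtain q where q: "q \<in> hom Z Y" "continuous_map (gtop Z) (gtop Y) q"
      "\<forall>g\<in>carrier G. j g = q (k g)"
    using assms(2) unfolding compactification_le_def by blast
  have "p \<circ> q \<in> hom Z X"
    using p(1) q(1) by (auto simp: hom_def)
  moreover have "continuous_map (gtop Z) (gtop X) (p \<circ> q)"
    using p(2) q(2) continuous_map_compose by blast
  ultimately show ?thesis
    unfolding compactification_le_def using p(3) q(3) by (intro exI[of _ "p \<circ> q"]) auto
qed

text \<open>
  Transport of a compactification along an injection: the group is \<open>flatten\<close>ed and the topology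
  pulled back along the inverse.
\<close>

lemma compactification_transport:
  fixes X :: "'x topgroup" and e :: "'x \<Rightarrow> 'y"
  assumes comp: "group_compactification G X i" and inj: "inj_on e (carrier X)"
  shows "\<exists>(Y :: 'y topgroup) j. group_compactification G Y j \<and> compactification_equiv G X i Y j"
proof -
  define d where "d = the_inv_into (carrier X) e"
  define C where "C = e ` carrier X"
  define T where "T = pullback_topology C d (gtop X)"
  define Y :: "'y topgroup" where
    "Y = \<lparr>carrier = C, monoid.mult = (\<lambda>a b. e (d a \<otimes>\<^bsub>X\<^esub> d b)), one = e \<one>\<^bsub>X\<^esub>, gtop = T\<rparr>"
  have cX: "compact_group X" and ihom: "i \<in> hom G X"
    and icont: "continuous_map (gtop G) (gtop X) i"
    and dense: "gtop X closure_of (i ` carrier G) = carrier X"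
    using comp by (auto simp: group_compactification_def)
  have tX: "topological_group X" and cpt: "compact_space (gtop X)" and T2: "Hausdorff_space (gtop X)"
    using cX by (auto simp: compact_group_def)
  have gX: "group X" and tsX: "topspace (gtop X) = carrier X"
    and multc: "continuous_map (prod_topology (gtop X) (gtop X)) (gtop X) (\<lambda>(x, y). x \<otimes>\<^bsub>X\<^esub> y)"
    and invc: "continuous_map (gtop X) (gtop X) (\<lambda>x. inv\<^bsub>X\<^esub> x)"
    using tX by (auto simp: topological_group_def)
  interpret X: group X by (rule gX)
  have de [simp]: "d (e x) = x" if "x \<in> carrier X" for x
    using inj that by (simp add: d_def the_inv_into_f_f)
  have dC: "d a \<in> carrier X" and ed [simp]: "e (d a) = a" if "a \<in> C" for a
    using that by (auto simp: C_def)
  have tsT: "topspace T = C"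
    using dC tsX by (auto simp: T_def topspace_pullback_topology)
  have dcont: "continuous_map T (gtop X) d"
    unfolding T_def using continuous_map_pullback[of "gtop X" "gtop X" id C d] by simp
  have econt: "continuous_map (gtop X) T e"
    unfolding T_def
  proof (rule continuous_map_pullback')
    have "continuous_map (gtop X) (gtop X) id" by simp
    then show "continuous_map (gtop X) (gtop X) (d \<circ> e)"
      by (rule continuous_map_eq) (simp add: tsX)
  qed (auto simp: tsX C_def)
  have hom_maps: "homeomorphic_maps (gtop X) T e d"
    unfolding homeomorphic_maps_def using econt dcont by (simp add: tsX tsT)
  have hs: "gtop X homeomorphic_space T"
    using hom_maps homeomorphic_space_def by blast
  have gY: "group Y"
  proof (rule groupI)
    fix a assume a: "a \<in> carrier Y"
    show "\<exists>b\<in>carrier Y. b \<otimes>\<^bsub>Y\<^esub> a = \<one>\<^bsub>Y\<^esub>"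
      using a dC[of a] by (intro bexI[of _ "e (inv\<^bsub>X\<^esub> (d a))"]) (auto simp: Y_def C_def)
  qed (use dC in \<open>auto simp: Y_def C_def X.m_assoc\<close>)
  have carY: "carrier Y = C" and topY: "gtop Y = T"
    by (simp_all add: Y_def)
  have dhom: "d \<in> hom Y X" and ehom: "e \<in> hom X Y"
    using dC by (auto simp: hom_def Y_def C_def)
  interpret Y: group Y by (rule gY)
  have invY: "inv\<^bsub>Y\<^esub> a = e (inv\<^bsub>X\<^esub> (d a))" if "a \<in> C" for a
  proof (rule Y.inv_equality)
    show "e (inv\<^bsub>X\<^esub> (d a)) \<otimes>\<^bsub>Y\<^esub> a = \<one>\<^bsub>Y\<^esub>" "a \<in> carrier Y" "e (inv\<^bsub>X\<^esub> (d a)) \<in> carrier Y"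
      using that dC[of a] by (auto simp: Y_def C_def)
  qed
  have "continuous_map (prod_topology T T) (prod_topology (gtop X) (gtop X)) (\<lambda>(a, b). (d a, d b))"
    using dcont by (simp add: continuous_map_prod_top)
  from continuous_map_compose[OF this multc]
  have "continuous_map (prod_topology T T) (gtop X) (\<lambda>(a, b). d a \<otimes>\<^bsub>X\<^esub> d b)"
    by (rule continuous_map_eq) auto
  from continuous_map_compose[OF this econt]
  have multY: "continuous_map (prod_topology T T) T (\<lambda>(a, b). a \<otimes>\<^bsub>Y\<^esub> b)"
    by (rule continuous_map_eq) (auto simp: Y_def)
  from continuous_map_compose[OF continuous_map_compose[OF dcont invc] econt]
  have "continuous_map T T (\<lambda>a. inv\<^bsub>Y\<^esub> a)"
    by (rule continuous_map_eq) (auto simp: tsT invY)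
  then have "topological_group Y"
    unfolding topological_group_def using gY multY tsT by (simp add: carY topY)
  moreover have "compact_space T" "Hausdorff_space T"
    using hs cpt T2 homeomorphic_compact_space homeomorphic_Hausdorff_space by blast+
  ultimately have cY: "compact_group Y"
    by (simp add: compact_group_def topY)
  have "T closure_of ((e \<circ> i) ` carrier G) = e ` (gtop X closure_of (i ` carrier G))"
  proof -
    have "homeomorphic_map (gtop X) T e"
      using hom_maps homeomorphic_maps_map by blast
    moreover have "i ` carrier G \<subseteq> topspace (gtop X)"
      using ihom tsX by (auto simp: hom_def)
    ultimately show ?thesis
      using homeomorphic_map_closure_of[of "gtop X" T e "i ` carrier G"]
      by (simp add: image_image)
  qed
  then have "gtop Y closure_of ((e \<circ> i) ` carrier G) = carrier Y"
    using dense by (simp add: carY topY C_def)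
  moreover have "e \<circ> i \<in> hom G Y"
    using ihom ehom by (auto simp: hom_def Pi_iff)
  moreover have "continuous_map (gtop G) (gtop Y) (e \<circ> i)"
    unfolding topY using icont econt continuous_map_compose by blast
  ultimately have "group_compactification G Y (e \<circ> i)"
    using cY by (simp add: group_compactification_def)
  moreover have "compactification_equiv G X i Y (e \<circ> i)"
    unfolding compactification_equiv_def compactification_le_def
    using dhom ehom dcont econt ihom by (auto simp: topY hom_def Pi_iff)
  ultimately show ?thesis by blast
qed

text \<open>
  A point of a compactification is determined by the traces on the group of its open
  neighbourhoods.
\<close>

lemma compactification_canonical:
  fixes G :: "'g topgroup" and X :: "'x topgroup"
  assumes comp: "group_compactification G X i"
  shows "\<exists>(Y :: 'g set set topgroup) j. group_compactification G Y j \<and> compactification_equiv G X i Y j"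
proof -
  define e :: "'x \<Rightarrow> 'g set set" where
    "e x = {i -` U \<inter> carrier G | U. openin (gtop X) U \<and> x \<in> U}" for x
  have T2: "Hausdorff_space (gtop X)" and ts: "topspace (gtop X) = carrier X"
    and dense: "gtop X closure_of (i ` carrier G) = carrier X"
    using comp by (auto simp: group_compactification_def compact_group_def topological_group_def)
  have "inj_on e (carrier X)"
  proof (rule inj_onI, rule ccontr)
    fix x y assume xy: "x \<in> carrier X" "y \<in> carrier X" "e x = e y" "x \<noteq> y"
    then obtain U V where UV: "openin (gtop X) U" "openin (gtop X) V" "x \<in> U" "y \<in> V" "disjnt U V"
      using T2 ts unfolding Hausdorff_space_def by metis
    have "i -` U \<inter> carrier G \<in> e y"
      using UV xy(3) unfolding e_def by blast
    then obtain W where W: "i -` U \<inter> carrier G = i -` W \<inter> carrier G" "openin (gtop X) W" "y \<in> W"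
      unfolding e_def by blast
    have "openin (gtop X) (W \<inter> V)" "y \<in> W \<inter> V"
      using W UV by auto
    moreover have "y \<in> gtop X closure_of (i ` carrier G)"
      using dense xy by simp
    ultimately obtain g where "g \<in> carrier G" "i g \<in> W \<inter> V"
      unfolding in_closure_of by blast
    then show False
      using W(1) UV(5) by (auto simp: disjnt_iff)
  qed
  from compactification_transport[OF comp this] show ?thesis .
qed

lemma bohr_compactification_maximal:
  assumes "bohr_compactification G B \<iota>B" "group_compactification G X i"
  shows "compactification_le G X i B \<iota>B"
proof -
  obtain Y :: "'a set set topgroup" and j
    where Y: "group_compactification G Y j" "compactification_equiv G X i Y j"
    using compactification_canonical[OF assms(2)] by blast
  have "compactification_le G Y j B \<iota>B"
    using assms(1) Y(1) unfolding bohr_compactification_def by blast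
  then show ?thesis
    using Y(2) compactification_le_trans unfolding compactification_equiv_def by blast
qed

end

theory Submission
  imports Defs
begin

text \<open>
  Both compactifications are quotients \<open>\<pi>\<^sub>i : bG \<rightarrow> X\<^sub>i\<close> of the Bohr compactification. The mean of
  \<open>\<bar>\<phi> - \<psi>\<^sub>i \<circ> \<iota>\<^sub>i\<bar>\<close> is an integral over \<open>bG\<close>, so both \<open>\<psi>\<^sub>1 \<circ> \<pi>\<^sub>1\<close> and \<open>\<psi>\<^sub>2 \<circ> \<pi>\<^sub>2\<close> agree almost
  everywhere with a realization of \<open>\<phi>\<close> on \<open>bG\<close>. An element \<open>k\<close> of the kernel of \<open>\<pi>\<^sub>1\<close> is a period of
  the former, hence \<open>\<pi>\<^sub>2 k\<close> is an \<open>L1\<close> period of \<open>\<psi>\<^sub>2\<close>, and aperiodicity puts \<open>k\<close> in the kernel of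
  \<open>\<pi>\<^sub>2\<close>. By symmetry the kernels coincide, so each \<open>\<pi>\<^sub>i\<close> factors continuously through the other.
\<close>

section \<open>Points of continuity\<close>

lemma topcontinuous_at_compose:
  assumes "topcontinuous_at X Y f x" "topcontinuous_at Y Z g (f x)"
  shows "topcontinuous_at X Z (\<lambda>x. g (f x)) x"
  unfolding topcontinuous_at_def
proof (intro conjI allI impI)
  show "x \<in> topspace X" "(\<lambda>x. g (f x)) \<in> topspace X \<rightarrow> topspace Z"
    using assms unfolding topcontinuous_at_def by auto
  fix W assume "openin Z W \<and> g (f x) \<in> W"
  then obtain V where V: "openin Y V" "f x \<in> V" "\<forall>y\<in>V. g y \<in> W"
    using assms(2) unfolding topcontinuous_at_def by blast
  then obtain U where U: "openin X U" "x \<in> U" "\<forall>y\<in>U. f y \<in> V"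
    using assms(1) unfolding topcontinuous_at_def by blast
  then show "\<exists>U. openin X U \<and> x \<in> U \<and> (\<forall>y\<in>U. g (f y) \<in> W)"
    using V(3) by blast
qed

lemma topcontinuous_at_euclideanE:
  assumes "topcontinuous_at X euclidean f x" "open V" "f x \<in> V"
  obtains U where "openin X U" "x \<in> U" "\<And>y. y \<in> U \<Longrightarrow> f y \<in> V"
  using assms by (auto simp: topcontinuous_at_def)

lemma topcontinuous_at_euclidean_iff:
  "topcontinuous_at X euclidean f x \<longleftrightarrow> x \<in> topspace X \<and> (f \<longlongrightarrow> f x) (atin X x)"
  by (simp add: topcontinuous_at_atin)

text \<open>If the values at \<open>x\<close> differed, disjoint neighbourhoods of them would keep
  \<open>f\<close> and \<open>g\<close> apart near \<open>x\<close>. This transfers agreement on a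
  dense set to common points of continuity.\<close>

lemma topcontinuous_at_agree:
  fixes f g :: "'a \<Rightarrow> 'b::t2_space"
  assumes f: "topcontinuous_at X euclidean f x" and g: "topcontinuous_at X euclidean g x"
    and agree: "\<And>U. \<lbrakk>openin X U; x \<in> U\<rbrakk> \<Longrightarrow> \<exists>y\<in>U. f y = g y"
  shows "f x = g x"
proof (rule ccontr)
  assume "f x \<noteq> g x"
  then obtain V W where VW: "open V" "open W" "f x \<in> V" "g x \<in> W" "V \<inter> W = {}"
    using hausdorff[OF \<open>f x \<noteq> g x\<close>] by blast
  obtain A where A: "openin X A" "x \<in> A" "\<forall>y\<in>A. f y \<in> V"
    using topcontinuous_at_euclideanE[OF f VW(1,3)] by metis
  obtain B where B: "openin X B" "x \<in> B" "\<forall>y\<in>B. g y \<in> W"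
    using topcontinuous_at_euclideanE[OF g VW(2,4)] by metis
  obtain y where "y \<in> A \<inter> B" "f y = g y"
    using agree[of "A \<inter> B"] A B by blast
  then show False
    using A(3) B(3) VW(5) by (metis IntE disjoint_iff)
qed

text \<open>Continuity at a point means neighbourhoods of arbitrarily small oscillation. This makes
  the set a countable intersection of open sets for arbitrary \<open>f\<close>, so discontinuity
  sets are Borel.\<close>

lemma topcontinuous_points_Inter:
  fixes f :: "'a \<Rightarrow> 'b::metric_space"
  shows "{x \<in> topspace X. topcontinuous_at X euclidean f x} =
    (\<Inter>n. \<Union>{U. openin X U \<and> (\<forall>y\<in>U. \<forall>z\<in>U. dist (f y) (f z) < inverse (Suc n))})"
    (is "?L = (\<Inter>n. ?R n)")
proof
  show "?L \<subseteq> (\<Inter>n. ?R n)"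
  proof clarify
    fix x n assume x: "topcontinuous_at X euclidean f x"
    let ?e = "inverse (real (Suc n))"
    have "f x \<in> ball (f x) (?e / 2)"
      by simp
    then obtain U where U: "openin X U" "x \<in> U" "\<And>y. y \<in> U \<Longrightarrow> f y \<in> ball (f x) (?e / 2)"
      using topcontinuous_at_euclideanE[OF x open_ball] by metis
    have "dist (f y) (f z) < ?e" if "y \<in> U" "z \<in> U" for y z
    proof (rule dist_triangle_half_l)
      show "dist (f y) (f x) < ?e / 2" "dist (f z) (f x) < ?e / 2"
        using U(3)[OF that(1)] U(3)[OF that(2)] by (simp_all only: mem_ball dist_commute)
    qed
    then show "x \<in> ?R n"
      using U by blast
  qed
  show "(\<Inter>n. ?R n) \<subseteq> ?L"
  proof
    fix x assume x: "x \<in> (\<Inter>n. ?R n)"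
    have "\<exists>U. openin X U \<and> x \<in> U \<and> (\<forall>y\<in>U. f y \<in> V)" if V: "open V" "f x \<in> V" for V
    proof -
      obtain e where e: "e > 0" "ball (f x) e \<subseteq> V"
        using openE[OF V] by metis
      obtain n where n: "inverse (real (Suc n)) < e"
        using reals_Archimedean e(1) by blast
      obtain U where U: "openin X U" "x \<in> U"
          "\<forall>y\<in>U. \<forall>z\<in>U. dist (f y) (f z) < inverse (Suc n)"
        using x by blast
      then have "\<forall>y\<in>U. f y \<in> V"
        using n e(2) by (meson less_trans mem_ball subsetD)
      then show ?thesis
        using U by blast
    qed
    moreover have "x \<in> topspace X"
      using x openin_subset by fastforce
    ultimately show "x \<in> ?L"
      by (simp add: topcontinuous_at_def)
  qed
qed

section \<open>Haar measure on a compact group\<close>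

text \<open>A compact group with a normalized, invariant, regular Borel measure, to be instantiated
  at the Bohr compactification and at its two quotients.\<close>

locale haar_group =
  fixes X :: "'x topgroup" (structure) and \<mu> :: "'x measure"
  assumes compact_group: "compact_group X" and haar: "haar_measure X \<mu>"
begin

lemma group_X: "group X"
  and topspace_eq [simp]: "topspace (gtop X) = carrier X"
  and compact_X: "compact_space (gtop X)"
  and Hausdorff_X: "Hausdorff_space (gtop X)"
  and continuous_mult: "continuous_map (prod_topology (gtop X) (gtop X)) (gtop X) (\<lambda>(x, y). x \<otimes> y)"
  using compact_group unfolding compact_group_def topological_group_def by auto

sublocale group X by (rule group_X)

lemma space_eq [simp]: "space \<mu> = carrier X"
  and sets_eq: "sets \<mu> = sigma_sets (carrier X) {U. openin (gtop X) U}"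
  and emeasure_carrier: "emeasure \<mu> (carrier X) = 1"
  and emeasure_l_coset: "\<lbrakk>x \<in> carrier X; A \<in> sets \<mu>\<rbrakk> \<Longrightarrow> emeasure \<mu> (x <# A) = emeasure \<mu> A"
  and outer_regular:
    "A \<in> sets \<mu> \<Longrightarrow> emeasure \<mu> A = (INF U\<in>{U. openin (gtop X) U \<and> A \<subseteq> U}. emeasure \<mu> U)"
  and inner_regular:
    "A \<in> sets \<mu> \<Longrightarrow> emeasure \<mu> A =
      (SUP K\<in>{K. compactin (gtop X) K \<and> closedin (gtop X) K \<and> K \<subseteq> A}. emeasure \<mu> K)"
  using haar unfolding haar_measure_def by blast+

lemma finite_measure_completion: "finite_measure (completion \<mu>)"
proof
  have "carrier X \<in> sets \<mu>"
    using sets.top[of \<mu>] by simp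
  then show "emeasure (completion \<mu>) (space (completion \<mu>)) \<noteq> \<infinity>"
    by (simp add: emeasure_carrier)
qed

lemma open_sets: "openin (gtop X) U \<Longrightarrow> U \<in> sets \<mu>"
  by (auto simp: sets_eq)

lemma closed_sets: "closedin (gtop X) K \<Longrightarrow> K \<in> sets \<mu>"
  using open_sets[of "carrier X - K"] sets.Diff[of "carrier X" \<mu> "carrier X - K"] sets.top[of \<mu>]
  by (auto simp: closedin_def double_diff)

lemma measurable_continuous_map:
  assumes "haar_group Y \<nu>" "continuous_map (gtop Y) (gtop X) f"
  shows "f \<in> measurable \<nu> \<mu>"
proof -
  interpret Y: haar_group Y \<nu> by fact
  show ?thesis
  proof (rule measurable_sigma_sets[OF sets_eq])
    show "{U. openin (gtop X) U} \<subseteq> Pow (carrier X)"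
      using openin_subset by fastforce
    show "f \<in> space \<nu> \<rightarrow> carrier X"
      using continuous_map_funspace[OF assms(2)] by simp
    fix U assume "U \<in> {U. openin (gtop X) U}"
    then have "openin (gtop Y) {y \<in> topspace (gtop Y). f y \<in> U}"
      using assms(2) openin_continuous_map_preimage by blast
    moreover have "{y \<in> topspace (gtop Y). f y \<in> U} = f -` U \<inter> space \<nu>"
      by auto
    ultimately show "f -` U \<inter> space \<nu> \<in> sets \<nu>"
      using Y.open_sets by simp
  qed
qed

section \<open>Translations and sets of full measure\<close>

lemma continuous_mult_left:
  assumes "a \<in> carrier X" shows "continuous_map (gtop X) (gtop X) (\<lambda>x. a \<otimes> x)"
proof -
  have "continuous_map (gtop X) (prod_topology (gtop X) (gtop X)) (\<lambda>x. (a, x))"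
    using assms by (simp add: continuous_map_pairedI)
  from continuous_map_compose[OF this continuous_mult] show ?thesis
    by (simp add: comp_def)
qed

lemma continuous_mult_right:
  assumes "a \<in> carrier X" shows "continuous_map (gtop X) (gtop X) (\<lambda>x. x \<otimes> a)"
proof -
  have "continuous_map (gtop X) (prod_topology (gtop X) (gtop X)) (\<lambda>x. (x, a))"
    using assms by (simp add: continuous_map_pairedI)
  from continuous_map_compose[OF this continuous_mult] show ?thesis
    by (simp add: comp_def)
qed

lemma preimage_mult_left:
  assumes "a \<in> carrier X" "A \<subseteq> carrier X"
  shows "{x \<in> carrier X. a \<otimes> x \<in> A} = inv a <# A"
proof
  show "{x \<in> carrier X. a \<otimes> x \<in> A} \<subseteq> inv a <# A"
  proof
    fix x assume x: "x \<in> {x \<in> carrier X. a \<otimes> x \<in> A}"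
    then have "x = inv a \<otimes> (a \<otimes> x)"
      using assms(1) by (simp add: m_assoc[symmetric])
    with x show "x \<in> inv a <# A"
      unfolding l_coset_def by blast
  qed
  show "inv a <# A \<subseteq> {x \<in> carrier X. a \<otimes> x \<in> A}"
    using assms by (auto simp: l_coset_def m_assoc[symmetric])
qed

lemma emeasure_preimage_mult_left:
  assumes "a \<in> carrier X" "A \<in> sets \<mu>"
  shows "emeasure \<mu> {x \<in> carrier X. a \<otimes> x \<in> A} = emeasure \<mu> A"
  using assms sets.sets_into_space[OF assms(2)] by (simp add: preimage_mult_left emeasure_l_coset)

text \<open>The exceptional null set pulls back to a translate of itself, which is null by
  invariance.\<close>

lemma AE_mult_left:
  assumes "a \<in> carrier X" "AE x in \<mu>. P x"
  shows "AE x in \<mu>. P (a \<otimes> x)"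
proof -
  obtain N where N: "N \<in> null_sets \<mu>" "{x \<in> space \<mu>. \<not> P x} \<subseteq> N"
    using assms(2) unfolding eventually_ae_filter by auto
  have "(\<lambda>x. a \<otimes> x) \<in> measurable \<mu> \<mu>"
    using measurable_continuous_map[OF haar_group_axioms continuous_mult_left[OF assms(1)]] .
  then have "{x \<in> carrier X. a \<otimes> x \<in> N} \<in> sets \<mu>"
    using measurable_sets[of _ \<mu> \<mu> N] N(1) by (simp add: vimage_def Collect_conj_eq Int_commute null_setsD2)
  then have "{x \<in> carrier X. a \<otimes> x \<in> N} \<in> null_sets \<mu>"
    using N(1) assms(1) emeasure_preimage_mult_left[of a N] by (auto simp: null_sets_def)
  then show ?thesis
    using N(2) assms(1) by (intro AE_I') auto
qed

text \<open>By compactness finitely many translates of \<open>U\<close> cover the group; were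
  \<open>U\<close> null, the whole group would be null.\<close>

lemma emeasure_open_pos:
  assumes U: "openin (gtop X) U" and ne: "U \<noteq> {}"
  shows "emeasure \<mu> U \<noteq> 0"
proof
  assume 0: "emeasure \<mu> U = 0"
  obtain u where u: "u \<in> U" "u \<in> carrier X"
    using U ne openin_subset by fastforce
  define T where "T a = {x \<in> carrier X. a \<otimes> x \<in> U}" for a
  have T: "openin (gtop X) (T a)" if "a \<in> carrier X" for a
    using openin_continuous_map_preimage[OF continuous_mult_left[OF that] U] by (simp add: T_def)
  \<comment> \<open>Left multiplication by \<open>u \<otimes> inv x\<close> moves \<open>x\<close>
    to \<open>u\<close>, so the sets \<open>T a\<close> cover the group.\<close>
  have "x \<in> T (u \<otimes> inv x)" if "x \<in> carrier X" for x
    using that u by (simp add: T_def m_assoc)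
  then have "carrier X \<subseteq> \<Union>(T ` carrier X)"
    using u(2) by (meson UN_I inv_closed m_closed subsetI)
  moreover have "\<And>V. V \<in> T ` carrier X \<Longrightarrow> openin (gtop X) V"
    using T by blast
  ultimately obtain \<F> where F: "finite \<F>" "\<F> \<subseteq> T ` carrier X" "carrier X \<subseteq> \<Union>\<F>"
    using compactinD[of "gtop X" "carrier X" "T ` carrier X"] compact_X
    unfolding compact_space_def by auto
  have "T a \<in> null_sets \<mu>" if "a \<in> carrier X" for a
    using emeasure_preimage_mult_left[OF that open_sets[OF U]] open_sets[OF T[OF that]] 0
    by (simp add: T_def null_sets_def)
  then have "\<Union>\<F> \<in> null_sets \<mu>"
    using F(2) by (intro null_sets.finite_Union[OF F(1)]) blast
  then have "carrier X \<in> null_sets \<mu>"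
    using F(3) null_sets_subset[of "\<Union>\<F>" \<mu> "carrier X"] sets.top[of \<mu>] by auto
  then show False
    using emeasure_carrier by auto
qed

text \<open>Sets of full measure are dense, since nonempty open sets are not null. An almost
  everywhere identity thus holds somewhere in every neighbourhood.\<close>

lemma AE_meets_open:
  assumes "AE x in \<mu>. P x" "openin (gtop X) U" "U \<noteq> {}"
  obtains x where "x \<in> U" "P x"
proof -
  have "\<exists>x\<in>U. P x"
  proof (rule ccontr)
    assume "\<not> ?thesis"
    then have "AE x in \<mu>. x \<notin> U"
      using assms(1) by (auto elim: eventually_mono)
    then show False
      using assms emeasure_open_pos open_sets AE_iff_null_sets by blast
  qed
  then show thesis using that by blast
qed

section \<open>Riemann integrable functions\<close>

lemma discontinuities_sets:
  fixes f :: "'x \<Rightarrow> 'c::metric_space"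
  shows "{x \<in> carrier X. \<not> topcontinuous_at (gtop X) euclidean f x} \<in> sets \<mu>"
proof -
  define R where "R n = \<Union>{U. openin (gtop X) U \<and>
    (\<forall>y\<in>U. \<forall>z\<in>U. dist (f y) (f z) < inverse (real (Suc n)))}" for n
  have "openin (gtop X) (R n)" for n
    unfolding R_def by (rule openin_Union) blast
  then have "(\<Inter>n. R n) \<in> sets \<mu>"
    by (intro sets.countable_INT) (auto intro: open_sets)
  moreover have "{x \<in> carrier X. topcontinuous_at (gtop X) euclidean f x} = (\<Inter>n. R n)"
    using topcontinuous_points_Inter[of "gtop X" f] unfolding R_def topspace_eq .
  ultimately have "{x \<in> carrier X. topcontinuous_at (gtop X) euclidean f x} \<in> sets \<mu>"
    by simp
  then have "carrier X - {x \<in> carrier X. topcontinuous_at (gtop X) euclidean f x} \<in> sets \<mu>"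
    using sets.compl_sets by fastforce
  moreover have "carrier X - {x \<in> carrier X. topcontinuous_at (gtop X) euclidean f x} =
      {x \<in> carrier X. \<not> topcontinuous_at (gtop X) euclidean f x}"
    by blast
  ultimately show ?thesis
    by simp
qed

text \<open>Membership in \<open>null_sets\<close> also demands measurability, which
  \<open>discontinuities_sets\<close> supplies for every \<open>f\<close>. The condition becomes an
  almost everywhere statement that combines with others.\<close>

lemma riemann_integrable_iff:
  "riemann_integrable X \<mu> f \<longleftrightarrow>
    bounded (f ` carrier X) \<and> (AE x in \<mu>. topcontinuous_at (gtop X) euclidean f x)"
  using AE_iff_null[of \<mu> "topcontinuous_at (gtop X) euclidean f"] discontinuities_sets[of f]
  by (simp add: riemann_integrable_def)

text \<open>The preimage of an open set is an open set together with a subset of a null set; such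
  subsets are measurable in the completion.\<close>

lemma borel_measurable_completion:
  fixes f :: "'x \<Rightarrow> 'c::topological_space"
  assumes "AE x in \<mu>. topcontinuous_at (gtop X) euclidean f x"
  shows "f \<in> borel_measurable (completion \<mu>)"
proof (rule borel_measurableI)
  fix S :: "'c set" assume S: "open S"
  obtain N where N: "N \<in> null_sets \<mu>"
      "{x \<in> space \<mu>. \<not> topcontinuous_at (gtop X) euclidean f x} \<subseteq> N"
    using assms unfolding eventually_ae_filter by auto
  \<comment> \<open>The largest open set that \<open>f\<close> maps into \<open>S\<close>; it
    contains every point of continuity with value in \<open>S\<close>.\<close>
  define W where "W = \<Union>{U. openin (gtop X) U \<and> f ` U \<subseteq> S}"
  have W: "openin (gtop X) W"
    unfolding W_def by (rule openin_Union) auto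
  have "x \<in> W" if "x \<in> carrier X" "f x \<in> S" "x \<notin> N" for x
  proof -
    have "topcontinuous_at (gtop X) euclidean f x"
      using that N by auto
    then obtain U where "openin (gtop X) U" "x \<in> U" "\<And>y. y \<in> U \<Longrightarrow> f y \<in> S"
      using topcontinuous_at_euclideanE S \<open>f x \<in> S\<close> by metis
    then show ?thesis
      by (auto simp: W_def)
  qed
  moreover have "W \<subseteq> f -` S \<inter> carrier X"
    using openin_subset[OF W] by (auto simp: W_def)
  ultimately have "f -` S \<inter> carrier X = W \<union> (f -` S \<inter> carrier X \<inter> N)"
    by auto
  then have "f -` S \<inter> carrier X \<in> sets (completion \<mu>)"
    using N(1) open_sets[OF W] by (intro sets_completionI) auto
  then show "f -` S \<inter> space (completion \<mu>) \<in> sets (completion \<mu>)"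
    by simp
qed

lemma riemann_integrable_imp_integrable:
  assumes "riemann_integrable X \<mu> f"
  shows "integrable (completion \<mu>) f"
proof -
  obtain b where b: "\<forall>x\<in>carrier X. cmod (f x) \<le> b"
    using assms unfolding riemann_integrable_def bounded_iff by auto
  show ?thesis
  proof (rule finite_measure.integrable_const_bound[OF finite_measure_completion])
    show "AE x in completion \<mu>. norm (f x) \<le> b"
      using b by (intro AE_I2) simp
    show "f \<in> borel_measurable (completion \<mu>)"
      using assms by (intro borel_measurable_completion) (simp add: riemann_integrable_iff)
  qed
qed

section \<open>Null sets under surjective homomorphisms\<close>

lemma mult_nbhd_of_compact:
  assumes K: "compactin (gtop X) K" and U: "openin (gtop X) U" "K \<subseteq> U"
  obtains V where "openin (gtop X) V" "\<one> \<in> V" "\<And>v k. \<lbrakk>v \<in> V; k \<in> K\<rbrakk> \<Longrightarrow> v \<otimes> k \<in> U"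
proof -
  let ?P = "prod_topology (gtop X) (gtop X)"
  \<comment> \<open>The preimage of \<open>U\<close> under multiplication is open and contains
    \<open>{\<one>} \<times> K\<close>; Wallace's theorem fits an open box between the two.\<close>
  define W where "W = {p \<in> topspace ?P. (case p of (x, y) \<Rightarrow> x \<otimes> y) \<in> U}"
  have W: "openin ?P W"
    unfolding W_def using continuous_mult U(1) by (rule openin_continuous_map_preimage)
  have "K \<subseteq> carrier X"
    using compactin_subset_topspace[OF K] by simp
  then have "{\<one>} \<times> K \<subseteq> W"
    using U(2) by (auto simp: W_def subset_iff)
  then obtain V L where "openin (gtop X) V" "\<one> \<in> V" "K \<subseteq> L" "V \<times> L \<subseteq> W"
    using Wallace_theorem_prod_topology[of "gtop X" "{\<one>}" "gtop X" K W] K W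
    by (metis compactin_sing insert_subset one_closed topspace_eq)
  then show thesis
    using that[of V] by (force simp: W_def)
qed

end

text \<open>
  Preimages of null sets are null; this replaces the uniqueness of Haar measure. Choose a
  neighbourhood \<open>V\<close> of the unit with \<open>V K \<subseteq> U\<close> and a finite Borel partition of \<open>X\<close> into sets
  \<open>A\<^sub>i \<subseteq> V c\<^sub>i\<close>. For fixed \<open>y\<close> the \<open>A\<^sub>i\<close> with \<open>c\<^sub>i \<cdot> \<pi> y \<in> K\<close> lie in \<open>{x. x \<cdot> \<pi> y \<in> U}\<close>, which has
  measure \<open>\<mu> U\<close>; integrating over \<open>y\<close> gives the bound.
\<close>

lemma emeasure_preimage_compact_le:
  assumes "haar_group B \<beta>" "haar_group X \<mu>" "comm_group X"
    and \<pi>: "\<pi> \<in> hom B X" "continuous_map (gtop B) (gtop X) \<pi>" "\<pi> ` carrier B = carrier X"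
    and K: "compactin (gtop X) K" and U: "openin (gtop X) U" "K \<subseteq> U"
  shows "emeasure \<beta> {y \<in> carrier B. \<pi> y \<in> K} \<le> emeasure \<mu> U"
proof -
  interpret B: haar_group B \<beta> by fact
  interpret X: haar_group X \<mu> by fact
  interpret C: comm_group X by fact
  have \<pi>c [simp]: "\<pi> y \<in> carrier X" if "y \<in> carrier B" for y
    using \<pi>(1) that by (auto simp: hom_def)
  obtain V where V: "openin (gtop X) V" "\<one>\<^bsub>X\<^esub> \<in> V"
      "\<And>v k. \<lbrakk>v \<in> V; k \<in> K\<rbrakk> \<Longrightarrow> v \<otimes>\<^bsub>X\<^esub> k \<in> U"
    using X.mult_nbhd_of_compact[OF K U] by blast
  \<comment> \<open>The right translate of \<open>V\<close> by \<open>a\<close>, written as a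
    preimage so that openness is immediate.\<close>
  define T where "T a = {x \<in> carrier X. x \<otimes>\<^bsub>X\<^esub> inv\<^bsub>X\<^esub> a \<in> V}" for a
  have T: "openin (gtop X) (T a)" if "a \<in> carrier X" for a
    using openin_continuous_map_preimage[OF X.continuous_mult_right[of "inv\<^bsub>X\<^esub> a"] V(1)] that
    by (simp add: T_def)
  have "carrier X \<subseteq> \<Union>(T ` carrier X)"
    using V(2) by (auto simp: T_def)
  moreover have "\<And>W. W \<in> T ` carrier X \<Longrightarrow> openin (gtop X) W"
    using T by blast
  ultimately obtain \<F> where F: "finite \<F>" "\<F> \<subseteq> T ` carrier X" "carrier X \<subseteq> \<Union>\<F>"
    using compactinD[of "gtop X" "carrier X" "T ` carrier X"] X.compact_X
    unfolding compact_space_def by auto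
  obtain C where C: "finite C" "C \<subseteq> carrier X" "\<F> = T ` C"
    using finite_subset_image[OF F(1,2)] by blast
  obtain c :: "nat \<Rightarrow> 'b" and n where c: "c ` {0..<n} = C"
    using finite_imp_nat_seg_image_inj_on[OF C(1)] by (metis atLeast0LessThan lessThan_def)
  \<comment> \<open>Disjointification works on sequences, hence the enumeration of the centres and
    the empty sets from index \<open>n\<close> on.\<close>
  define A where "A = disjointed (\<lambda>i. if i < n then T (c i) else {})"
  have cC: "c i \<in> carrier X" if "i < n" for i
    using c C(2) that by auto
  have Asub: "A i \<subseteq> T (c i)" for i
    unfolding A_def using disjointed_subset[of "\<lambda>i. if i < n then T (c i) else {}" i]
    by (auto split: if_splits)
  have Asets: "A i \<in> sets \<mu>" for i
  proof -
    have "range (\<lambda>i. if i < n then T (c i) else {}) \<subseteq> sets \<mu>"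
      using T cC X.open_sets by auto
    from sets.range_disjointed_sets[OF this] show ?thesis
      by (auto simp: A_def)
  qed
  have Adisj: "disjoint_family_on A I" for I
    using disjoint_family_disjointed disjoint_family_on_mono[OF subset_UNIV] unfolding A_def by blast
  have "(\<Union>i\<in>{0..<n}. A i) = (\<Union>i\<in>{0..<n}. T (c i))"
    unfolding A_def finite_UN_disjointed_eq by simp
  then have AUN: "(\<Union>i<n. A i) = carrier X"
    using F(3) C(3) c by (auto simp: T_def atLeast0LessThan)
  define D where "D i = {y \<in> carrier B. c i \<otimes>\<^bsub>X\<^esub> \<pi> y \<in> K}" for i
  define E where "E = {y \<in> carrier B. \<pi> y \<in> K}"
  have "closedin (gtop X) K"
    using K X.Hausdorff_X compactin_imp_closedin by blast
  then have E: "E \<in> sets \<beta>"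
    using closedin_continuous_map_preimage[OF \<pi>(2)] B.closed_sets by (simp add: E_def)
  \<comment> \<open>Surjectivity gives a preimage \<open>b\<close> of the centre \<open>c i\<close>.
    Then \<open>D i\<close> is a translate of \<open>E\<close>, so invariance of
    \<open>\<beta>\<close> gives both sets the same measure.\<close>
  have D: "D i \<in> sets \<beta> \<and> emeasure \<beta> (D i) = emeasure \<beta> E" if i: "i < n" for i
  proof -
    obtain b where b: "b \<in> carrier B" "\<pi> b = c i"
      using \<pi>(3) cC[OF i] by (metis imageE)
    have "D i = {y \<in> carrier B. b \<otimes>\<^bsub>B\<^esub> y \<in> E}"
      using b \<pi>(1) by (auto simp: D_def E_def hom_def)
    moreover have "{y \<in> carrier B. b \<otimes>\<^bsub>B\<^esub> y \<in> E} \<in> sets \<beta>"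
      using measurable_sets[OF B.measurable_continuous_map[OF B.haar_group_axioms
            B.continuous_mult_left[OF b(1)]] E]
      by (simp add: vimage_def Collect_conj_eq Int_commute)
    ultimately show ?thesis
      using B.emeasure_preimage_mult_left[OF b(1) E] by simp
  qed
  have pw: "(\<Sum>i<n. emeasure \<mu> (A i) * indicator (D i) y) \<le> emeasure \<mu> U"
    if y: "y \<in> carrier B" for y
  proof -
    let ?I = "{i. i < n \<and> y \<in> D i}"
    have "(\<Sum>i<n. emeasure \<mu> (A i) * indicator (D i) y) = (\<Sum>i\<in>?I. emeasure \<mu> (A i))"
      by (rule sum.mono_neutral_cong_right) (auto simp: indicator_def)
    also have "\<dots> = emeasure \<mu> (\<Union>i\<in>?I. A i)"
      using Asets Adisj by (intro sum_emeasure) auto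
    also have "\<dots> \<le> emeasure \<mu> {x \<in> carrier X. \<pi> y \<otimes>\<^bsub>X\<^esub> x \<in> U}"
    proof (rule emeasure_mono)
      show "{x \<in> carrier X. \<pi> y \<otimes>\<^bsub>X\<^esub> x \<in> U} \<in> sets \<mu>"
        using openin_continuous_map_preimage[OF X.continuous_mult_left[of "\<pi> y"] U(1)] y
          X.open_sets by simp
      show "(\<Union>i\<in>?I. A i) \<subseteq> {x \<in> carrier X. \<pi> y \<otimes>\<^bsub>X\<^esub> x \<in> U}"
      proof clarify
        fix i x assume i: "i < n" "y \<in> D i" "x \<in> A i"
        then have x: "x \<in> carrier X" "x \<otimes>\<^bsub>X\<^esub> inv\<^bsub>X\<^esub> (c i) \<in> V"
          using Asub by (auto simp: T_def)
        \<comment> \<open>A product of an element of \<open>V\<close> and one of \<open>K\<close>.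
          It cancels to the product of \<open>x\<close> and \<open>\<pi> y\<close>, and
          commutativity moves \<open>\<pi> y\<close> to the left, where invariance of
          \<open>\<mu>\<close> applies.\<close>
        have "(x \<otimes>\<^bsub>X\<^esub> inv\<^bsub>X\<^esub> (c i)) \<otimes>\<^bsub>X\<^esub> (c i \<otimes>\<^bsub>X\<^esub> \<pi> y) \<in> U"
          using V(3) x(2) i(2) by (auto simp: D_def)
        also have "(x \<otimes>\<^bsub>X\<^esub> inv\<^bsub>X\<^esub> (c i)) \<otimes>\<^bsub>X\<^esub> (c i \<otimes>\<^bsub>X\<^esub> \<pi> y) = \<pi> y \<otimes>\<^bsub>X\<^esub> x"
        proof -
          have "inv\<^bsub>X\<^esub> (c i) \<otimes>\<^bsub>X\<^esub> (c i \<otimes>\<^bsub>X\<^esub> \<pi> y) = \<pi> y"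
            using cC[OF i(1)] y by (simp add: X.m_assoc[symmetric])
          then show ?thesis
            using cC[OF i(1)] y x(1) C.m_comm[of x "\<pi> y"] by (simp add: X.m_assoc)
        qed
        finally show "x \<in> carrier X \<and> \<pi> y \<otimes>\<^bsub>X\<^esub> x \<in> U"
          using x by blast
      qed
    qed
    also have "\<dots> = emeasure \<mu> U"
      using y U(1) X.open_sets by (simp add: X.emeasure_preimage_mult_left)
    finally show ?thesis .
  qed
  \<comment> \<open>The inserted factor is 1, the total mass of the partition. Each summand becomes
    the integral of a multiple of the indicator of \<open>D i\<close>, and \<open>pw\<close> bounds
    the integrand.\<close>
  have "emeasure \<beta> E = (\<Sum>i<n. emeasure \<mu> (A i)) * emeasure \<beta> E"
    using sum_emeasure[of A "{..<n}" \<mu>] Asets Adisj AUN X.emeasure_carrier by (simp add: image_subset_iff)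
  also have "\<dots> = (\<Sum>i<n. emeasure \<mu> (A i) * emeasure \<beta> (D i))"
    using D by (simp add: sum_distrib_right)
  also have "\<dots> = (\<integral>\<^sup>+ y. (\<Sum>i<n. emeasure \<mu> (A i) * indicator (D i) y) \<partial>\<beta>)"
    using D by (subst nn_integral_sum)
      (auto simp: nn_integral_cmult_indicator intro!: borel_measurable_times_ennreal borel_measurable_indicator)
  also have "\<dots> \<le> (\<integral>\<^sup>+ y. emeasure \<mu> U \<partial>\<beta>)"
    using pw by (intro nn_integral_mono) simp
  also have "\<dots> = emeasure \<mu> U"
    by (simp add: B.emeasure_carrier)
  finally show ?thesis
    by (simp add: E_def)
qed

text \<open>Inner regularity on \<open>B\<close> reduces the claim to compact subsets of the
  preimage of a null set. The image of such a subset is compact and null, so outer regularity gives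
  it open neighbourhoods of arbitrarily small measure, and these bound the measure of the
  subset.\<close>

lemma AE_preimage_hom:
  assumes B: "haar_group B \<beta>" and X: "haar_group X \<mu>" and comm: "comm_group X"
    and \<pi>: "\<pi> \<in> hom B X" "continuous_map (gtop B) (gtop X) \<pi>" "\<pi> ` carrier B = carrier X"
    and P: "AE x in \<mu>. P x"
  shows "AE y in \<beta>. P (\<pi> y)"
proof -
  interpret B: haar_group B \<beta> by fact
  interpret X: haar_group X \<mu> by fact
  obtain N where N: "N \<in> null_sets \<mu>" "{x \<in> space \<mu>. \<not> P x} \<subseteq> N"
    using P unfolding eventually_ae_filter by auto
  define M where "M = {y \<in> carrier B. \<pi> y \<in> N}"
  have M: "M \<in> sets \<beta>"
    using measurable_sets[OF X.measurable_continuous_map[OF B \<pi>(2)], of N] N(1)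
    by (simp add: M_def vimage_def Collect_conj_eq Int_commute null_setsD2)
  have "emeasure \<beta> C \<le> 0" if C: "compactin (gtop B) C" "C \<subseteq> M" for C
  proof -
    define K where "K = \<pi> ` C"
    have K: "compactin (gtop X) K" "K \<subseteq> N"
      using image_compactin[OF C(1) \<pi>(2)] C(2) by (auto simp: K_def M_def)
    then have Ks: "K \<in> sets \<mu>"
      using X.Hausdorff_X compactin_imp_closedin X.closed_sets by blast
    have KC: "closedin (gtop X) K"
      using K X.Hausdorff_X compactin_imp_closedin by blast
    have "emeasure \<beta> C \<le> emeasure \<beta> {y \<in> carrier B. \<pi> y \<in> K}"
      using closedin_continuous_map_preimage[OF \<pi>(2) KC] B.closed_sets
        compactin_subset_topspace[OF C(1)] by (intro emeasure_mono) (auto simp: K_def)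
    also have "\<dots> \<le> (INF U\<in>{U. openin (gtop X) U \<and> K \<subseteq> U}. emeasure \<mu> U)"
      using emeasure_preimage_compact_le[OF B X comm \<pi> K(1)] by (intro INF_greatest) auto
    also have "\<dots> = emeasure \<mu> K"
      using X.outer_regular[OF Ks] by simp
    also have "\<dots> = 0"
      using N(1) K(2) Ks null_sets_subset by blast
    finally show ?thesis .
  qed
  then have "emeasure \<beta> M \<le> 0"
    unfolding B.inner_regular[OF M] by (intro SUP_least) auto
  then have "M \<in> null_sets \<beta>"
    using M by auto
  moreover have "{y \<in> space \<beta>. \<not> P (\<pi> y)} \<subseteq> M"
    using N(2) \<pi>(1) by (auto simp: M_def hom_def)
  ultimately show ?thesis
    by (rule AE_I')
qed

section \<open>Compactifications and almost realizations\<close>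

text \<open>The image of \<open>\<pi>\<close> is compact, hence closed, and contains the dense image
  of \<open>G\<close>.\<close>

lemma hom_closure_range:
  assumes B: "group_compactification G B \<iota>B" and X: "group_compactification G X \<iota>"
    and \<pi>: "\<pi> \<in> hom B X" "continuous_map (gtop B) (gtop X) \<pi>" "\<And>g. g \<in> carrier G \<Longrightarrow> \<iota> g = \<pi> (\<iota>B g)"
  shows "\<pi> ` carrier B = carrier X"
proof
  have ts: "topspace (gtop B) = carrier B" "compact_space (gtop B)"
    using B by (auto simp: group_compactification_def compact_group_def topological_group_def)
  show "\<pi> ` carrier B \<subseteq> carrier X"
    using \<pi>(1) by (auto simp: hom_def)
  have "compactin (gtop X) (\<pi> ` carrier B)"
    using image_compactin[OF _ \<pi>(2)] ts unfolding compact_space_def by metis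
  moreover have "Hausdorff_space (gtop X)"
    using X by (auto simp: group_compactification_def compact_group_def)
  ultimately have "closedin (gtop X) (\<pi> ` carrier B)"
    using compactin_imp_closedin by blast
  moreover have "\<iota> ` carrier G \<subseteq> \<pi> ` carrier B"
    using B \<pi>(3) by (auto simp: group_compactification_def hom_def)
  ultimately have "gtop X closure_of (\<iota> ` carrier G) \<subseteq> \<pi> ` carrier B"
    by (rule closure_of_minimal[rotated])
  then show "carrier X \<subseteq> \<pi> ` carrier B"
    using X by (simp add: group_compactification_def)
qed

lemma haar_group_compactification:
  assumes "group_compactification G X \<iota>" "haar_measure X \<mu>"
  shows "haar_group X \<mu>"
  using assms by (simp add: haar_group_def group_compactification_def)

text \<open>Commutativity passes from the dense image of \<open>G\<close> to the whole group by
  continuity, one factor at a time.\<close>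

lemma comm_group_compactification:
  assumes G: "comm_group G" and X: "group_compactification G X \<iota>" and \<mu>: "haar_measure X \<mu>"
  shows "comm_group X"
proof -
  interpret G: comm_group G by fact
  interpret X: haar_group X \<mu>
    using haar_group_compactification[OF X \<mu>] .
  have hom: "\<iota> \<in> hom G X" and dense: "gtop X closure_of (\<iota> ` carrier G) = carrier X"
    using X by (auto simp: group_compactification_def)
  have \<iota>: "\<iota> g \<in> carrier X" if "g \<in> carrier G" for g
    using hom that by (auto simp: hom_def)
  \<comment> \<open>Both sides are continuous in \<open>x\<close> with values in a Hausdorff space,
    so equality extends from the dense image.\<close>
  have dense_comm: "x \<otimes>\<^bsub>X\<^esub> a = a \<otimes>\<^bsub>X\<^esub> x"
    if "x \<in> carrier X" "a \<in> carrier X"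
      "\<And>g. g \<in> carrier G \<Longrightarrow> \<iota> g \<otimes>\<^bsub>X\<^esub> a = a \<otimes>\<^bsub>X\<^esub> \<iota> g" for x a
  proof (rule forall_in_closure_of_eq[OF _ X.Hausdorff_X X.continuous_mult_right X.continuous_mult_left])
    show "x \<in> gtop X closure_of (\<iota> ` carrier G)"
      using that(1) dense by simp
  qed (use that in auto)
  have "x \<otimes>\<^bsub>X\<^esub> \<iota> h = \<iota> h \<otimes>\<^bsub>X\<^esub> x" if x: "x \<in> carrier X" and h: "h \<in> carrier G" for x h
  proof (rule dense_comm[OF x \<iota>[OF h]])
    fix g assume g: "g \<in> carrier G"
    have "\<iota> (g \<otimes>\<^bsub>G\<^esub> h) = \<iota> (h \<otimes>\<^bsub>G\<^esub> g)"
      using g h by (simp add: G.m_comm)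
    then show "\<iota> g \<otimes>\<^bsub>X\<^esub> \<iota> h = \<iota> h \<otimes>\<^bsub>X\<^esub> \<iota> g"
      using hom g h by (simp add: hom_mult)
  qed
  then have "x \<otimes>\<^bsub>X\<^esub> y = y \<otimes>\<^bsub>X\<^esub> x" if "x \<in> carrier X" "y \<in> carrier X" for x y
    using dense_comm[OF that] that by simp
  then show ?thesis
    by (intro X.group_comm_groupI) auto
qed

text \<open>The definite description is well defined: two realizations agree on the dense image of
  \<open>G\<close>, hence at common points of continuity, hence almost everywhere.\<close>

lemma hartman_mean_eq_integral:
  assumes X: "group_compactification G X \<iota>" and \<mu>: "haar_measure X \<mu>"
    and f: "riemann_integrable X \<mu> f" and \<phi>: "\<And>g. g \<in> carrier G \<Longrightarrow> \<phi> g = f (\<iota> g)"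
  shows "hartman_mean G X \<iota> \<mu> \<phi> = haar_integral \<mu> f"
  unfolding hartman_mean_def
proof (rule the_equality)
  interpret X: haar_group X \<mu>
    using haar_group_compactification[OF X \<mu>] .
  fix c
  assume "\<exists>h. riemann_integrable X \<mu> h \<and> (\<forall>g\<in>carrier G. \<phi> g = h (\<iota> g)) \<and> c = haar_integral \<mu> h"
  then obtain h where h: "riemann_integrable X \<mu> h" "\<And>g. g \<in> carrier G \<Longrightarrow> \<phi> g = h (\<iota> g)"
      "c = haar_integral \<mu> h"
    by blast
  have eq: "h x = f x" if x: "topcontinuous_at (gtop X) euclidean h x" "topcontinuous_at (gtop X) euclidean f x" for x
  proof (rule topcontinuous_at_agree[OF x])
    fix U assume U: "openin (gtop X) U" "x \<in> U"
    have "x \<in> gtop X closure_of (\<iota> ` carrier G)"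
      using X U openin_subset by (fastforce simp: group_compactification_def)
    then obtain g where "g \<in> carrier G" "\<iota> g \<in> U"
      using U unfolding in_closure_of by blast
    then show "\<exists>y\<in>U. h y = f y"
      using h(2) \<phi> by metis
  qed
  have "AE x in \<mu>. h x = f x"
    using f h(1) eq unfolding X.riemann_integrable_iff by (auto elim: eventually_elim2)
  then have "integral\<^sup>L (completion \<mu>) h = integral\<^sup>L (completion \<mu>) f"
    using X.riemann_integrable_imp_integrable[OF f] X.riemann_integrable_imp_integrable[OF h(1)]
    by (intro integral_cong_AE) (auto simp: AE_completion_iff)
  then show "c = haar_integral \<mu> f"
    using h(3) by (simp add: haar_integral_def)
qed (use f \<phi> in blast)

text \<open>The distance between \<open>f\<close> and \<open>\<psi> \<circ> \<pi>\<close> is a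
  Riemann integrable realization of the function whose mean vanishes. A nonnegative function with
  zero integral is zero almost everywhere.\<close>

lemma almost_realization_AE:
  assumes G: "comm_group G"
    and B: "group_compactification G B \<iota>B" and \<beta>: "haar_measure B \<beta>"
    and X: "group_compactification G X \<iota>" and \<mu>: "haar_measure X \<mu>"
    and \<pi>: "\<pi> \<in> hom B X" "continuous_map (gtop B) (gtop X) \<pi>" "\<And>g. g \<in> carrier G \<Longrightarrow> \<iota> g = \<pi> (\<iota>B g)"
    and f: "riemann_integrable B \<beta> f" "\<And>g. g \<in> carrier G \<Longrightarrow> \<phi> g = f (\<iota>B g)"
    and \<psi>: "almost_realization G B \<iota>B \<beta> \<phi> X \<iota> \<mu> \<psi>"
  shows "AE y in \<beta>. f y = \<psi> (\<pi> y)"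
proof -
  interpret B: haar_group B \<beta>
    using haar_group_compactification[OF B \<beta>] .
  interpret X: haar_group X \<mu>
    using haar_group_compactification[OF X \<mu>] .
  define h where "h y = cmod (f y - \<psi> (\<pi> y))" for y
  have \<psi>r: "riemann_integrable X \<mu> \<psi>"
    and mean: "hartman_mean G B \<iota>B \<beta> (\<lambda>g. complex_of_real (cmod (\<phi> g - \<psi> (\<iota> g)))) = 0"
    using \<psi> by (auto simp: almost_realization_def)
  \<comment> \<open>The discontinuities of \<open>\<psi>\<close> pull back to a null set, which
    keeps \<open>\<psi> \<circ> \<pi>\<close> Riemann integrable on \<open>B\<close>.\<close>
  have "AE y in \<beta>. topcontinuous_at (gtop X) euclidean \<psi> (\<pi> y)"
    using AE_preimage_hom[OF B.haar_group_axioms X.haar_group_axioms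
        comm_group_compactification[OF G X \<mu>] \<pi>(1,2) hom_closure_range[OF B X \<pi>]] \<psi>r
    by (simp add: X.riemann_integrable_iff)
  moreover have "AE y in \<beta>. topcontinuous_at (gtop B) euclidean f y"
    using f(1) by (simp add: B.riemann_integrable_iff)
  ultimately have cont: "AE y in \<beta>. topcontinuous_at (gtop B) euclidean (\<lambda>y. complex_of_real (h y)) y"
  proof eventually_elim
    case (elim y)
    then have "topcontinuous_at (gtop B) (gtop X) \<pi> y"
      using \<pi>(2) by (auto simp: continuous_map_eq_topcontinuous_at topcontinuous_at_def)
    then have "topcontinuous_at (gtop B) euclidean (\<lambda>y. \<psi> (\<pi> y)) y"
      using elim(1) by (rule topcontinuous_at_compose)
    with elim(2) show ?case
      unfolding topcontinuous_at_euclidean_iff h_def by (auto intro!: tendsto_intros)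
  qed
  obtain a b where a: "\<And>y. y \<in> carrier B \<Longrightarrow> cmod (f y) \<le> a"
    and b: "\<And>x. x \<in> carrier X \<Longrightarrow> cmod (\<psi> x) \<le> b"
    using f(1) \<psi>r unfolding riemann_integrable_def bounded_iff by auto
  have "h y \<le> a + b" if "y \<in> carrier B" for y
    using a[OF that] b[of "\<pi> y"] norm_triangle_ineq4[of "f y" "\<psi> (\<pi> y)"] that \<pi>(1)
    by (fastforce simp: h_def hom_def)
  then have "bounded ((\<lambda>y. complex_of_real (h y)) ` carrier B)"
    unfolding bounded_iff by (intro exI[of _ "a + b"]) (auto simp: h_def)
  with cont have hr: "riemann_integrable B \<beta> (\<lambda>y. complex_of_real (h y))"
    by (simp add: B.riemann_integrable_iff)
  have "haar_integral \<beta> (\<lambda>y. complex_of_real (h y)) = 0"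
    using hartman_mean_eq_integral[OF B \<beta> hr, of "\<lambda>g. complex_of_real (cmod (\<phi> g - \<psi> (\<iota> g)))"] mean f(2) \<pi>(3)
    by (simp add: h_def)
  then have "integral\<^sup>L (completion \<beta>) h = 0"
    by (simp add: haar_integral_def)
  moreover have "integrable (completion \<beta>) h"
    using B.riemann_integrable_imp_integrable[OF hr] by (simp only: complex_of_real_integrable_eq)
  ultimately have "AE y in completion \<beta>. h y = 0"
    by (subst (asm) integral_nonneg_eq_0_iff_AE) (auto simp: h_def)
  then show ?thesis
    by (simp add: AE_completion_iff h_def)
qed

text \<open>
  The function \<open>F\<close> agrees with \<open>\<psi> \<circ> \<pi>\<close> only almost everywhere, but its exact period \<open>k\<close> gives an
  \<open>L1\<close> period \<open>\<pi> k\<close> of \<open>\<psi>\<close>: sets of full measure are dense, so \<open>\<psi>\<close> and its translate agree at all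
  common points of continuity.
\<close>

lemma hom_period_eq_one:
  assumes B: "haar_group B \<beta>" and X: "haar_group X \<mu>"
    and \<pi>: "\<pi> \<in> hom B X" "continuous_map (gtop B) (gtop X) \<pi>" "\<pi> ` carrier B = carrier X"
    and \<psi>: "riemann_integrable X \<mu> \<psi>" "aperiodic X \<mu> \<psi>"
    and F: "AE y in \<beta>. F y = \<psi> (\<pi> y)"
    and k: "k \<in> carrier B" "\<And>y. y \<in> carrier B \<Longrightarrow> F (k \<otimes>\<^bsub>B\<^esub> y) = F y"
  shows "\<pi> k = \<one>\<^bsub>X\<^esub>"
proof -
  interpret B: haar_group B \<beta> by fact
  interpret X: haar_group X \<mu> by fact
  have pk: "\<pi> k \<in> carrier X"
    using \<pi>(1) k(1) by (auto simp: hom_def)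
  have "AE y in \<beta>. F (k \<otimes>\<^bsub>B\<^esub> y) = \<psi> (\<pi> (k \<otimes>\<^bsub>B\<^esub> y))"
    using B.AE_mult_left[OF k(1) F] .
  \<comment> \<open>\<open>F\<close> agrees with \<open>\<psi> \<circ> \<pi>\<close> both at
    \<open>y\<close> and at its translate by \<open>k\<close>, for almost every \<open>y\<close>;
    the exact period links the two values.\<close>
  with F AE_space[of \<beta>] have per: "AE y in \<beta>. \<psi> (\<pi> y) = \<psi> (\<pi> k \<otimes>\<^bsub>X\<^esub> \<pi> y)"
  proof eventually_elim
    case (elim y)
    then have "y \<in> carrier B"
      by simp
    with elim show ?case
      using k hom_mult[OF \<pi>(1) k(1)] by metis
  qed
  have eq: "\<psi> x = \<psi> (\<pi> k \<otimes>\<^bsub>X\<^esub> x)"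
    if x: "topcontinuous_at (gtop X) euclidean \<psi> x"
      "topcontinuous_at (gtop X) euclidean \<psi> (\<pi> k \<otimes>\<^bsub>X\<^esub> x)" for x
  proof (rule topcontinuous_at_agree[OF x(1)])
    have "x \<in> carrier X"
      using x(1) by (simp add: topcontinuous_at_def)
    then have "topcontinuous_at (gtop X) (gtop X) (\<lambda>x. \<pi> k \<otimes>\<^bsub>X\<^esub> x) x"
      using X.continuous_mult_left[OF pk] by (simp add: continuous_map_eq_topcontinuous_at)
    then show "topcontinuous_at (gtop X) euclidean (\<lambda>x. \<psi> (\<pi> k \<otimes>\<^bsub>X\<^esub> x)) x"
      using x(2) by (rule topcontinuous_at_compose)
    fix U assume U: "openin (gtop X) U" "x \<in> U"
    \<comment> \<open>A point over \<open>x\<close> makes the open preimage of \<open>U\<close>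
      nonempty, so it meets the set of full measure where \<open>per\<close> holds.\<close>
    obtain b where "b \<in> carrier B" "\<pi> b = x"
      using \<pi>(3) \<open>x \<in> carrier X\<close> by (metis imageE)
    then have ne: "{y \<in> carrier B. \<pi> y \<in> U} \<noteq> {}"
      using U by blast
    have "openin (gtop B) {y \<in> carrier B. \<pi> y \<in> U}"
      using openin_continuous_map_preimage[OF \<pi>(2) U(1)] by simp
    from B.AE_meets_open[OF per this ne]
    obtain y where "y \<in> {y \<in> carrier B. \<pi> y \<in> U}" "\<psi> (\<pi> y) = \<psi> (\<pi> k \<otimes>\<^bsub>X\<^esub> \<pi> y)"
      by blast
    then show "\<exists>z\<in>U. \<psi> z = \<psi> (\<pi> k \<otimes>\<^bsub>X\<^esub> z)"
      by blast
  qed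
  have "AE x in \<mu>. topcontinuous_at (gtop X) euclidean \<psi> x"
    using \<psi>(1) by (simp add: X.riemann_integrable_iff)
  with X.AE_mult_left[OF pk this] have "AE x in \<mu>. \<psi> x = \<psi> (\<pi> k \<otimes>\<^bsub>X\<^esub> x)"
    using eq by (auto elim: eventually_elim2)
  then have "L1_norm \<mu> (\<lambda>y. \<psi> y - group_translate X (\<pi> k) \<psi> y) = 0"
    unfolding L1_norm_def group_translate_def
    by (intro integral_eq_zero_AE) (simp add: AE_completion_iff)
  then show ?thesis
    using \<psi>(2) pk unfolding aperiodic_def by blast
qed

section \<open>Factoring one quotient through the other\<close>

lemma hom_factor_quotient:
  assumes "group B" "group X" "group Y"
    and p: "p \<in> hom B X" "continuous_map (gtop B) (gtop X) p" "p ` carrier B = carrier X"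
    and q: "q \<in> hom B Y" "continuous_map (gtop B) (gtop Y) q"
    and top: "topspace (gtop B) = carrier B" "topspace (gtop X) = carrier X"
      "compact_space (gtop B)" "Hausdorff_space (gtop X)"
    and ker: "\<And>k. \<lbrakk>k \<in> carrier B; p k = \<one>\<^bsub>X\<^esub>\<rbrakk> \<Longrightarrow> q k = \<one>\<^bsub>Y\<^esub>"
  obtains r where "r \<in> hom X Y" "continuous_map (gtop X) (gtop Y) r"
    "\<And>b. b \<in> carrier B \<Longrightarrow> r (p b) = q b"
proof -
  interpret P: group_hom B X p
    using assms by (simp add: group_hom_def group_hom_axioms_def)
  interpret Q: group_hom B Y q
    using assms by (simp add: group_hom_def group_hom_axioms_def)
  \<comment> \<open>A continuous surjection from a compact onto a Hausdorff space is closed, hence a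
    quotient map. This yields continuity of the factor \<open>r\<close>.\<close>
  have "quotient_map (gtop B) (gtop X) p"
    using p top by (intro continuous_imp_quotient_map) auto
  moreover have "q x = q y" if xy: "x \<in> topspace (gtop B)" "y \<in> topspace (gtop B)" "p x = p y" for x y
  proof -
    \<comment> \<open>Points of one fibre of \<open>p\<close> differ by an element of its kernel,
      which \<open>q\<close> kills; so \<open>q\<close> is constant on fibres.\<close>
    have "p (x \<otimes>\<^bsub>B\<^esub> inv\<^bsub>B\<^esub> y) = \<one>\<^bsub>X\<^esub>"
      using xy top by simp
    then have "q (x \<otimes>\<^bsub>B\<^esub> inv\<^bsub>B\<^esub> y) = \<one>\<^bsub>Y\<^esub>"
      using xy top by (intro ker) auto
    then have "q x \<otimes>\<^bsub>Y\<^esub> inv\<^bsub>Y\<^esub> q y = \<one>\<^bsub>Y\<^esub>"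
      using xy top by simp
    then show ?thesis
      using xy top by (metis Q.H.inv_equality Q.H.inv_inv Q.H.inv_closed Q.hom_closed)
  qed
  ultimately obtain r where r: "continuous_map (gtop X) (gtop Y) r"
      "r ` topspace (gtop X) = q ` topspace (gtop B)"
      "\<And>b. b \<in> topspace (gtop B) \<Longrightarrow> r (p b) = q b"
    using quotient_map_lift_exists[OF _ q(2)] by metis
  have "r \<in> hom X Y"
  proof (rule homI)
    fix x assume "x \<in> carrier X"
    then obtain a where a: "a \<in> carrier B" "x = p a"
      using p(3) by blast
    then show "r x \<in> carrier Y"
      using r(3) top by simp
    fix y assume "y \<in> carrier X"
    then obtain b where b: "b \<in> carrier B" "y = p b"
      using p(3) by blast
    have "r (x \<otimes>\<^bsub>X\<^esub> y) = r (p (a \<otimes>\<^bsub>B\<^esub> b))"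
      using a b by simp
    also have "\<dots> = q (a \<otimes>\<^bsub>B\<^esub> b)"
      using a b top r(3)[of "a \<otimes>\<^bsub>B\<^esub> b"] by (simp del: P.hom_mult)
    finally show "r (x \<otimes>\<^bsub>X\<^esub> y) = r x \<otimes>\<^bsub>Y\<^esub> r y"
      using a b top r(3) by simp
  qed
  then show thesis
    using that r top by simp
qed

text \<open>Kernel elements of \<open>p\<close> are exact periods of
  \<open>\<psi> \<circ> p\<close>, which agrees almost everywhere with
  \<open>\<omega> \<circ> q\<close>. Aperiodicity of \<open>\<omega>\<close> puts them in the kernel
  of \<open>q\<close>, so \<open>q\<close> factors through \<open>p\<close>.\<close>

lemma aperiodic_almost_realization_le:
  assumes G: "comm_group G"
    and B: "group_compactification G B \<iota>B" and \<beta>: "haar_measure B \<beta>"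
    and \<phi>: "hartman_measurable G B \<iota>B \<beta> \<phi>"
    and X: "group_compactification G X \<iota>" and \<mu>: "haar_measure X \<mu>"
    and leX: "compactification_le G X \<iota> B \<iota>B"
    and Y: "group_compactification G Y \<kappa>" and \<nu>: "haar_measure Y \<nu>"
    and leY: "compactification_le G Y \<kappa> B \<iota>B"
    and \<psi>: "almost_realization G B \<iota>B \<beta> \<phi> X \<iota> \<mu> \<psi>"
    and \<omega>: "almost_realization G B \<iota>B \<beta> \<phi> Y \<kappa> \<nu> \<omega>" "aperiodic Y \<nu> \<omega>"
  shows "compactification_le G Y \<kappa> X \<iota>"
proof -
  interpret B: haar_group B \<beta>
    using haar_group_compactification[OF B \<beta>] .
  interpret X: haar_group X \<mu>
    using haar_group_compactification[OF X \<mu>] .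
  interpret Y: haar_group Y \<nu>
    using haar_group_compactification[OF Y \<nu>] .
  obtain p where p: "p \<in> hom B X" "continuous_map (gtop B) (gtop X) p"
      "\<And>g. g \<in> carrier G \<Longrightarrow> \<iota> g = p (\<iota>B g)"
    using leX unfolding compactification_le_def by blast
  obtain q where q: "q \<in> hom B Y" "continuous_map (gtop B) (gtop Y) q"
      "\<And>g. g \<in> carrier G \<Longrightarrow> \<kappa> g = q (\<iota>B g)"
    using leY unfolding compactification_le_def by blast
  obtain f where f: "riemann_integrable B \<beta> f" "\<And>g. g \<in> carrier G \<Longrightarrow> \<phi> g = f (\<iota>B g)"
    using \<phi> unfolding hartman_measurable_def by blast
  have "AE y in \<beta>. f y = \<psi> (p y)" "AE y in \<beta>. f y = \<omega> (q y)"
    using almost_realization_AE[OF G B \<beta> X \<mu> p f \<psi>] almost_realization_AE[OF G B \<beta> Y \<nu> q f \<omega>(1)] by blast+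
  \<comment> \<open>The realization \<open>f\<close> on \<open>B\<close> links the two almost
    realizations and drops out here.\<close>
  then have pq: "AE y in \<beta>. \<psi> (p y) = \<omega> (q y)"
    by eventually_elim simp
  have "\<psi> (p (k \<otimes>\<^bsub>B\<^esub> y)) = \<psi> (p y)"
    if "k \<in> carrier B" "p k = \<one>\<^bsub>X\<^esub>" "y \<in> carrier B" for k y
  proof -
    have "p y \<in> carrier X"
      using p(1) that(3) by (auto simp: hom_def)
    then show ?thesis
      using that by (simp add: hom_mult[OF p(1)])
  qed
  moreover have "riemann_integrable Y \<nu> \<omega>"
    using \<omega>(1) by (simp add: almost_realization_def)
  ultimately have ker: "q k = \<one>\<^bsub>Y\<^esub>" if "k \<in> carrier B" "p k = \<one>\<^bsub>X\<^esub>" for k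
    using that by (intro hom_period_eq_one[OF B.haar_group_axioms Y.haar_group_axioms q(1,2)
          hom_closure_range[OF B Y q] _ \<omega>(2) pq]) auto
  obtain r where r: "r \<in> hom X Y" "continuous_map (gtop X) (gtop Y) r"
      "\<And>b. b \<in> carrier B \<Longrightarrow> r (p b) = q b"
    using hom_factor_quotient[OF B.group_X X.group_X Y.group_X p(1,2) hom_closure_range[OF B X p] q(1,2)
        B.topspace_eq X.topspace_eq B.compact_X X.Hausdorff_X ker] by metis
  have "\<kappa> g = r (\<iota> g)" if "g \<in> carrier G" for g
  proof -
    have "\<iota>B g \<in> carrier B"
      using B that by (auto simp: group_compactification_def hom_def)
    then show ?thesis
      using p(3) q(3) r(3) that by simp
  qed
  then show ?thesis
    using r unfolding compactification_le_def by blast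
qed

theorem corollary7:
  fixes G :: "'g topgroup"
    and bG :: "'b topgroup" and \<iota>b :: "'g \<Rightarrow> 'b" and \<mu>b :: "'b measure"
    and X1 :: "'x topgroup" and \<iota>1 :: "'g \<Rightarrow> 'x" and \<mu>1 :: "'x measure"
    and X2 :: "'y topgroup" and \<iota>2 :: "'g \<Rightarrow> 'y" and \<mu>2 :: "'y measure"
    and \<phi> :: "'g \<Rightarrow> complex"
  assumes "LCA_group G"
    and "bohr_compactification G bG \<iota>b" and "haar_measure bG \<mu>b"
    and "hartman_measurable G bG \<iota>b \<mu>b \<phi>"
    and "group_compactification G X1 \<iota>1" and "haar_measure X1 \<mu>1"
    and "group_compactification G X2 \<iota>2" and "haar_measure X2 \<mu>2"
    and "\<exists>\<psi>1. almost_realization G bG \<iota>b \<mu>b \<phi> X1 \<iota>1 \<mu>1 \<psi>1 \<and> aperiodic X1 \<mu>1 \<psi>1"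
    and "\<exists>\<psi>2. almost_realization G bG \<iota>b \<mu>b \<phi> X2 \<iota>2 \<mu>2 \<psi>2 \<and> aperiodic X2 \<mu>2 \<psi>2"
  shows "compactification_equiv G X1 \<iota>1 X2 \<iota>2"
proof -
  have G: "comm_group G" and B: "group_compactification G bG \<iota>b"
    using assms(1,2) by (auto simp: LCA_group_def bohr_compactification_def)
  have le: "compactification_le G X1 \<iota>1 bG \<iota>b" "compactification_le G X2 \<iota>2 bG \<iota>b"
    using bohr_compactification_maximal assms(2,5,7) by blast+
  obtain \<psi>1 \<psi>2 where \<psi>: "almost_realization G bG \<iota>b \<mu>b \<phi> X1 \<iota>1 \<mu>1 \<psi>1" "aperiodic X1 \<mu>1 \<psi>1"
      "almost_realization G bG \<iota>b \<mu>b \<phi> X2 \<iota>2 \<mu>2 \<psi>2" "aperiodic X2 \<mu>2 \<psi>2"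
    using assms(9,10) by blast
  \<comment> \<open>Aperiodicity of \<open>\<psi>2\<close> puts \<open>X2\<close> below
    \<open>X1\<close>, and aperiodicity of \<open>\<psi>1\<close> puts \<open>X1\<close> below
    \<open>X2\<close>.\<close>
  show ?thesis
    unfolding compactification_equiv_def
    using aperiodic_almost_realization_le[OF G B assms(3,4) assms(5,6) le(1) assms(7,8) le(2) \<psi>(1,3,4)]
      aperiodic_almost_realization_le[OF G B assms(3,4) assms(7,8) le(2) assms(5,6) le(1) \<psi>(3,1,2)]
    by blast
qed

end
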